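(* Let $\mathcal L$ be a finite distributive lattice and $U_o\sqcup U_c=\mathcal P(\mathcal L)$ a partition of its set of join-irreducible elements. Then $C(I^{U_o,U_c}(\mathcal L),I^m(\mathcal L))$ consists exactly of the points $w\in\mathbb{R}^{\mathcal L}$ satisfying $w_a+w_b<w_{a\vee b}+w_{a\odot_{U_o,U_c}b}$ for all diamond pairs $\{a,b\}$ in $\mathcal L$. This description is minimal: for each diamond pair, the set of points of $\overline{C(I^{U_o,U_c}(\mathcal L),I^m(\mathcal L))}$ where equality $w_a+w_b=w_{a\vee b}+w_{a\odot_{U_o,U_c}b}$ holds is a facet of this closed cone.
   Context: $\mathcal P(\mathcal L)$ is the poset of join-irreducible elements (non-minimal elements covering exactly one element); $\iota(a)=\{p\in\mathcal P(\mathcal L):p\le a\}$, a lattice isomorphism from $\mathcal L$ onto the lattice of order ideals (lower sets) of $\mathcal P(\mathcal L)$. For an order ideal $J$, $K(J)$ is the set of elements of $J\cap U_o$ together with the elements of $J\cap U_c$ maximal in $J$. For order ideals $J_1,J_2$ there is a unique order ideal $J'$ with $\mathbf 1_{K(J_1)}+\mathbf 1_{K(J_2)}=\mathbf 1_{K(J_1\cup J_2)}+\mathbf 1_{K(J')}$; set $a\odot_{U_o,U_c}b=\iota^{-1}(J')$ for $J_1=\iota(a)$, $J_2=\iota(b)$. $R=\mathbb{C}[X_a:a\in\mathcal L]$; $I^{U_o,U_c}(\mathcal L)$ is the kernel of $R\to\mathbb{C}[z_p,t]$, $X_a\mapsto t\prod_{p\in K(\iota(a))}z_p$; $I^m(\mathcal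 L)$ is generated by $X_aX_b$ for incomparable $a,b$. For $w\in\mathbb{R}^{\mathcal L}$, $\mathrm{in}_wp$ is the part of $p$ of minimal $w$-weight, $\mathrm{in}_wI$ the span of all $\mathrm{in}_wp$, $p\in I$, and $C(I,J)=\{w:\mathrm{in}_wI=J\}$. A diamond pair is a two-element set $\{a,b\}$ with $a\vee b$ covering $a$ and $b$ and both covering $a\wedge b$. *)

theory Defs
  imports "HOL-Analysis.Analysis" "HOL-Library.Poly_Mapping"
begin

section \<open>Complex polynomials in variables indexed by a type\<close>

text \<open>Monomials are finitely supported exponent vectors, polynomials are finitely supported
  families of coefficients; the ring structure is the convolution product of Poly_Mapping.\<close>

type_synonym 'v monomial = "'v \<Rightarrow>\<^sub>0 nat"
type_synonym 'v cpoly = "'v monomial \<Rightarrow>\<^sub>0 complex"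

definition Const :: "complex \<Rightarrow> 'v cpoly" where
  "Const c = Poly_Mapping.single 0 c"

definition Var :: "'v \<Rightarrow> 'v cpoly" where
  "Var v = Poly_Mapping.single (Poly_Mapping.single v 1) 1"

definition cscale :: "complex \<Rightarrow> 'v cpoly \<Rightarrow> 'v cpoly" where
  "cscale c f = Const c * f"

text \<open>The \<open>\<complex>\<close>-algebra homomorphism sending each variable \<open>v\<close> to \<open>g v\<close>.\<close>

definition poly_subst :: "('v \<Rightarrow> 'u cpoly) \<Rightarrow> 'v cpoly \<Rightarrow> 'u cpoly" where
  "poly_subst g f =
     (\<Sum>m\<in>Poly_Mapping.keys f. Const (Poly_Mapping.lookup f m) *
        (\<Prod>v\<in>Poly_Mapping.keys m. g v ^ Poly_Mapping.lookup m v))"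

text \<open>Over \<open>(*)\<close> a module span is the generated ideal; over \<open>cscale\<close> it is the complex linear span.\<close>

global_interpretation ideal: module "(*) :: 'v cpoly \<Rightarrow> 'v cpoly \<Rightarrow> 'v cpoly"
  defines ideal_generated = ideal.span
  by unfold_locales (simp_all only: distrib_left distrib_right mult.assoc mult_1_left)

global_interpretation cpoly: vector_space "cscale :: complex \<Rightarrow> 'v cpoly \<Rightarrow> 'v cpoly"
  defines complex_span = cpoly.span
proof
  fix c d :: complex and f g :: "'v cpoly"
  show "cscale c (f + g) = cscale c f + cscale c g"
    by (simp add: cscale_def distrib_left)
  show "cscale (c + d) f = cscale c f + cscale d f"
    by (simp add: cscale_def Const_def single_add distrib_right)
  show "cscale c (cscale d f) = cscale (c * d) f"
    by (simp add: cscale_def Const_def mult_single flip: mult.assoc)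
  show "cscale 1 f = f"
    by (simp add: cscale_def Const_def)
qed

section \<open>Initial ideals\<close>

definition weight :: "real ^ 'a \<Rightarrow> 'a::finite monomial \<Rightarrow> real" where
  "weight w m = (\<Sum>a\<in>UNIV. real (Poly_Mapping.lookup m a) * w $ a)"

definition initial_form :: "real ^ 'a \<Rightarrow> 'a::finite cpoly \<Rightarrow> 'a cpoly" where
  "initial_form w f =
     (\<Sum>m | m \<in> Poly_Mapping.keys f \<and> (\<forall>m'\<in>Poly_Mapping.keys f. weight w m \<le> weight w m').
        Poly_Mapping.single m (Poly_Mapping.lookup f m))"

definition initial_ideal :: "real ^ 'a \<Rightarrow> 'a::finite cpoly set \<Rightarrow> 'a cpoly set" where
  "initial_ideal w I = complex_span (initial_form w ` I)"

definition groebner_cone :: "'a::finite cpoly set \<Rightarrow> 'a cpoly set \<Rightarrow> (real ^ 'a) set" where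
  "groebner_cone I J = {w. initial_ideal w I = J}"

section \<open>Join-irreducibles and order ideals\<close>

definition covers :: "'a::order \<Rightarrow> 'a \<Rightarrow> bool" where
  "covers a b \<longleftrightarrow> b < a \<and> \<not> (\<exists>c. b < c \<and> c < a)"

definition join_irreducibles :: "'a::order set" where
  "join_irreducibles = {p. (\<exists>q. q < p) \<and> (\<exists>!q. covers p q)}"

definition order_ideal :: "'a::order set \<Rightarrow> bool" where
  "order_ideal J \<longleftrightarrow>
     J \<subseteq> join_irreducibles \<and> (\<forall>p\<in>J. \<forall>q\<in>join_irreducibles. q \<le> p \<longrightarrow> q \<in> J)"

definition iota :: "'a::order \<Rightarrow> 'a set" where
  "iota a = {p \<in> join_irreducibles. p \<le> a}"

definition K_set :: "'a::order set \<Rightarrow> 'a set \<Rightarrow> 'a set \<Rightarrow> 'a set" where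
  "K_set Uo Uc J = (J \<inter> Uo) \<union> {p \<in> J \<inter> Uc. \<forall>q\<in>J. p \<le> q \<longrightarrow> q = p}"

definition odot_ideal :: "'a::order set \<Rightarrow> 'a set \<Rightarrow> 'a set \<Rightarrow> 'a set \<Rightarrow> 'a set" where
  "odot_ideal Uo Uc J1 J2 =
     (THE J'. order_ideal J' \<and>
        (\<forall>p. indicator (K_set Uo Uc J1) p + indicator (K_set Uo Uc J2) p =
             indicator (K_set Uo Uc (J1 \<union> J2)) p + (indicator (K_set Uo Uc J') p :: nat)))"

definition odot :: "'a::order set \<Rightarrow> 'a set \<Rightarrow> 'a \<Rightarrow> 'a \<Rightarrow> 'a" where
  "odot Uo Uc a b = inv iota (odot_ideal Uo Uc (iota a) (iota b))"

definition diamond_pair :: "'a::lattice \<Rightarrow> 'a \<Rightarrow> bool" where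
  "diamond_pair a b \<longleftrightarrow> a \<noteq> b \<and>
     covers (sup a b) a \<and> covers (sup a b) b \<and> covers a (inf a b) \<and> covers b (inf a b)"

section \<open>The ideals\<close>

text \<open>The target ring has variables indexed by \<open>'a option\<close>: \<open>None\<close> is \<open>t\<close> and \<open>Some p\<close> is
  \<open>z\<^sub>p\<close>. The variables \<open>Some p\<close> with \<open>p\<close> not join-irreducible never occur in an image, so they
  do not affect the kernel.\<close>

definition hibi_map :: "'a set \<Rightarrow> 'a set \<Rightarrow> 'a::order cpoly \<Rightarrow> 'a option cpoly" where
  "hibi_map Uo Uc = poly_subst (\<lambda>a. Var None * (\<Prod>p\<in>K_set Uo Uc (iota a). Var (Some p)))"

definition hibi_ideal :: "'a set \<Rightarrow> 'a set \<Rightarrow> 'a::order cpoly set" where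
  "hibi_ideal Uo Uc = {f. hibi_map Uo Uc f = 0}"

definition monomial_ideal :: "'a::order cpoly set" where
  "monomial_ideal = ideal_generated {Var a * Var b | a b. \<not> a \<le> b \<and> \<not> b \<le> a}"

end

theory Submission
  imports Defs
begin

text \<open>
  Write \<open>D(a, b) = w(a \<squnion> b) + w(a \<odot> b) - w(a) - w(b)\<close>. Since an order ideal \<open>J\<close> is the lower closure
  of \<open>K(J)\<close>, the largest element of a multichain can be read off the image of its monomial, so every
  fibre of the monomial map contains at most one chain monomial. Consequently, if \<open>D > 0\<close> on all
  incomparable pairs, replacing \<open>X\<^sub>a X\<^sub>b\<close> by \<open>X\<^sub>a\<^sub>\<squnion>\<^sub>b X\<^sub>a\<^sub>\<odot>\<^sub>b\<close> increases the weight, the chain monomial is the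
  unique heaviest one in its fibre, and the initial ideal is spanned by the non-chain monomials.

  Positivity on diamond pairs suffices: for \<open>a \<sqinter> b < c < a\<close> uniqueness of sorted pairs gives
  \<open>D(a, b) = D(c, b) + D(a, c \<squnion> b) + D(c \<odot> b, a \<odot> (c \<squnion> b))\<close>, and all three summands belong to smaller
  pairs. The weight \<open>3\<close> to the power of the rank lies in the cone; adding a suitable constant at \<open>a\<close>
  and \<open>b\<close> yields a point for which only the inequality of the pair \<open>a, b\<close> becomes an equality.
\<close>

section \<open>Finite distributive lattices\<close>

lemma exists_covered_above:
  fixes q p :: "'a::{finite,order}"
  assumes "q < p"
  shows "\<exists>r. q \<le> r \<and> covers p r"
proof -
  have "finite {r. q \<le> r \<and> r < p}" "{r. q \<le> r \<and> r < p} \<noteq> {}"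
    using assms by auto
  then obtain r where r: "r \<in> {r. q \<le> r \<and> r < p}"
    "\<forall>s\<in>{r. q \<le> r \<and> r < p}. r \<le> s \<longrightarrow> r = s"
    by (meson finite_has_maximal)
  then have "covers p r"
    unfolding covers_def by (auto dest: order_trans less_imp_le)
  with r show ?thesis by auto
qed

text \<open>If \<open>p\<close> were below neither \<open>a\<close> nor \<open>b\<close>, then
  \<open>inf p a\<close> and \<open>inf p b\<close> would be strictly below \<open>p\<close>, hence
  below its only lower cover \<open>q\<close>. Distributivity would then put \<open>p\<close> itself
  below \<open>q\<close>.\<close>

lemma join_irreducible_prime:
  fixes p :: "'a::{finite,distrib_lattice}"
  assumes p: "p \<in> join_irreducibles" and le: "p \<le> sup a b"
  shows "p \<le> a \<or> p \<le> b"
proof (rule ccontr)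
  assume "\<not> (p \<le> a \<or> p \<le> b)"
  then have "inf p a < p" "inf p b < p"
    by (auto simp: less_le inf.absorb_iff1 [symmetric])
  moreover obtain q where q: "covers p q" "\<And>r. covers p r \<Longrightarrow> r = q"
    using p unfolding join_irreducibles_def by auto
  ultimately have "inf p a \<le> q" "inf p b \<le> q"
    using exists_covered_above by metis+
  then have "inf p (sup a b) \<le> q"
    by (simp add: inf_sup_distrib1)
  then show False
    using le q(1) by (auto simp: inf.absorb1 covers_def dest: leD)
qed

text \<open>A minimal \<open>x\<close> below \<open>a\<close> but not below \<open>b\<close> works:
  two different lower covers would have join \<open>x\<close>, yet by minimality both lie below
  \<open>b\<close>. The element \<open>inf x b\<close> shows that \<open>x\<close> is not minimal in
  the lattice.\<close>

lemma join_irreducible_below: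
  fixes a b :: "'a::{finite,lattice}"
  assumes "\<not> a \<le> b"
  shows "\<exists>p\<in>join_irreducibles. p \<le> a \<and> \<not> p \<le> b"
proof -
  have "finite {x. x \<le> a \<and> \<not> x \<le> b}" "{x. x \<le> a \<and> \<not> x \<le> b} \<noteq> {}"
    using assms by auto
  then obtain x where x: "x \<le> a" "\<not> x \<le> b"
    and "\<forall>y\<in>{x. x \<le> a \<and> \<not> x \<le> b}. y \<le> x \<longrightarrow> x = y"
    by (metis (no_types, lifting) finite_has_minimal mem_Collect_eq)
  then have min: "y \<le> b" if "y < x" for y
    using that by (metis (no_types, lifting) less_le mem_Collect_eq order_trans)
  have "inf x b < x"
    using x by (auto simp: less_le inf.absorb_iff1 [symmetric])
  moreover from this obtain y where "covers x y"
    using exists_covered_above by blast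
  moreover have "q = r" if "covers x q" "covers x r" for q r
  proof (rule ccontr)
    assume "q \<noteq> r"
    have lt: "q < x" "r < x" and "\<not> (q < sup q r \<and> sup q r < x)" "\<not> (r < sup q r \<and> sup q r < x)"
      using that by (auto simp: covers_def)
    then have "sup q r = x"
      using \<open>q \<noteq> r\<close> by (metis le_sup_iff less_le sup_ge1 sup_ge2)
    then show False
      using lt min x(2) by (metis le_sup_iff)
  qed
  ultimately have "x \<in> join_irreducibles"
    unfolding join_irreducibles_def by blast
  with x show ?thesis by blast
qed

lemma iota_subset_iff:
  fixes a b :: "'a::{finite,lattice}"
  shows "iota a \<subseteq> iota b \<longleftrightarrow> a \<le> b"
  unfolding iota_def using join_irreducible_below [of a b] by (auto intro: order_trans)

lemma iota_eq_iff:
  fixes a b :: "'a::{finite,lattice}"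
  shows "iota a = iota b \<longleftrightarrow> a = b"
  by (metis iota_subset_iff order_antisym order_refl)

lemma iota_sup:
  fixes a b :: "'a::{finite,distrib_lattice}"
  shows "iota (sup a b) = iota a \<union> iota b"
  unfolding iota_def by (auto dest: join_irreducible_prime intro: le_supI1 le_supI2)

lemma iota_inf:
  fixes a b :: "'a::lattice"
  shows "iota (inf a b) = iota a \<inter> iota b"
  unfolding iota_def by auto

lemma order_ideal_iota: "order_ideal (iota a)"
  unfolding order_ideal_def iota_def by (auto intro: order_trans)

lemma join_irreducible_le_Sup_fin:
  fixes p :: "'a::{finite,distrib_lattice}"
  assumes p: "p \<in> join_irreducibles" and "finite A" "A \<noteq> {}"
  shows "p \<le> Sup_fin A \<Longrightarrow> \<exists>x\<in>A. p \<le> x"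
  using assms(2,3)
  by (induction A rule: finite_ne_induct) (auto dest: join_irreducible_prime [OF p])

text \<open>The element sought is the join of \<open>J\<close>; primality of join-irreducibles keeps
  new ones from appearing below it.\<close>

lemma order_ideal_imp_iota:
  fixes J :: "'a::{finite,distrib_lattice} set"
  assumes J: "order_ideal J"
  shows "\<exists>a. J = iota a"
proof -
  \<comment> \<open>The bottom element makes the finite join meaningful for empty \<open>J\<close>;
    no join-irreducible lies below it.\<close>
  define bt where "bt = Inf_fin (UNIV :: 'a set)"
  have bt: "bt \<le> x" for x
    unfolding bt_def by (simp add: Inf_fin.coboundedI)
  have "J = iota (Sup_fin (insert bt J))"
  proof (intro set_eqI iffI)
    fix p assume "p \<in> J"
    then show "p \<in> iota (Sup_fin (insert bt J))"
      using J by (auto simp: iota_def order_ideal_def intro!: Sup_fin.coboundedI)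
  next
    fix p assume "p \<in> iota (Sup_fin (insert bt J))"
    then have p: "p \<in> join_irreducibles" "p \<le> Sup_fin (insert bt J)"
      by (auto simp: iota_def)
    then obtain x where x: "x \<in> insert bt J" "p \<le> x"
      using join_irreducible_le_Sup_fin [of p "insert bt J"] by auto
    have "\<not> p \<le> bt"
      using p(1) bt by (auto simp: join_irreducibles_def dest: order_trans leD)
    with x p J show "p \<in> J"
      by (auto simp: order_ideal_def)
  qed
  then show ?thesis by blast
qed

text \<open>For a minimal \<open>p\<close> in \<open>iota a - iota c\<close>, the covering relation
  forces \<open>a = sup c p\<close>, and minimality of \<open>p\<close> leaves it as the only new
  element. Thus \<open>card (iota a)\<close> is the rank of \<open>a\<close>.\<close>

lemma card_iota_covers:
  fixes a c :: "'a::{finite,distrib_lattice}"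
  assumes "covers a c"
  shows "card (iota a) = Suc (card (iota c))"
proof -
  have ca: "c < a" and btw: "\<And>x. c < x \<Longrightarrow> \<not> x < a"
    using assms by (auto simp: covers_def)
  have "finite (iota a - iota c)" "iota a - iota c \<noteq> {}"
    using ca iota_subset_iff [of a c] by auto
  from finite_has_minimal [OF this] obtain p where p: "p \<in> iota a" "p \<notin> iota c"
    and min: "\<And>q. q \<in> iota a - iota c \<Longrightarrow> q \<le> p \<Longrightarrow> p = q"
    by blast
  have "c \<noteq> sup c p"
    using p by (metis (no_types, lifting) iota_def mem_Collect_eq sup_ge2)
  then have "c < sup c p" "sup c p \<le> a"
    using p ca by (auto simp: iota_def less_le)
  then have "a = sup c p"
    using btw [of "sup c p"] by (simp add: less_le)
  then have "iota a = iota c \<union> iota p"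
    by (simp add: iota_sup)
  moreover have "p \<in> iota p" "\<And>q. q \<in> iota p \<Longrightarrow> q \<le> p"
    using p(1) by (auto simp: iota_def)
  ultimately have "iota a = insert p (iota c)"
    using min by blast
  then show ?thesis
    using p(2) by simp
qed

text \<open>Every element of \<open>J\<close> lies below a maximal one, and maximal elements of
  \<open>J\<close> belong to \<open>K_set Uo Uc J\<close> whether they come from \<open>Uo\<close>
  or from \<open>Uc\<close>.\<close>

lemma iota_eq_lower_closure_K_set:
  fixes J :: "'a::{finite,order} set"
  assumes "order_ideal J" and "J \<subseteq> Uo \<union> Uc"
  shows "J = {q \<in> join_irreducibles. \<exists>p\<in>K_set Uo Uc J. q \<le> p}"
proof (intro set_eqI iffI)
  fix q assume q: "q \<in> J"
  have "finite {p \<in> J. q \<le> p}" "{p \<in> J. q \<le> p} \<noteq> {}"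
    using q by auto
  then obtain p where p: "p \<in> {p \<in> J. q \<le> p}" "\<forall>r\<in>{p \<in> J. q \<le> p}. p \<le> r \<longrightarrow> p = r"
    by (meson finite_has_maximal)
  then have "p \<in> K_set Uo Uc J"
    using assms(2) by (auto simp: K_set_def intro: order_trans)
  with p q assms(1) show "q \<in> {q \<in> join_irreducibles. \<exists>p\<in>K_set Uo Uc J. q \<le> p}"
    by (auto simp: order_ideal_def)
next
  fix q assume "q \<in> {q \<in> join_irreducibles. \<exists>p\<in>K_set Uo Uc J. q \<le> p}"
  then show "q \<in> J"
    using assms(1) by (auto simp: order_ideal_def K_set_def)
qed

lemma diamond_pairI:
  fixes a b :: "'a::distrib_lattice"
  assumes "\<not> a \<le> b" "\<not> b \<le> a"
    and a: "\<And>c. inf a b < c \<Longrightarrow> \<not> c < a" and b: "\<And>c. inf a b < c \<Longrightarrow> \<not> c < b"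
  shows "diamond_pair a b"
proof -
  have "covers (sup x y) x"
    if le: "\<not> y \<le> x" and y: "\<And>c. inf x y < c \<Longrightarrow> \<not> c < y" for x y :: 'a
    unfolding covers_def
  proof (intro conjI notI)
    show "x < sup x y"
      using le by (metis less_le sup_ge1 sup_ge2)
    assume "\<exists>c. x < c \<and> c < sup x y"
    then obtain c where c: "x < c" "c < sup x y"
      by blast
    \<comment> \<open>By this modular identity \<open>c\<close> is recovered from
      \<open>inf c y\<close>, so an element strictly between \<open>x\<close> and
      \<open>sup x y\<close> yields one strictly between \<open>inf x y\<close> and
      \<open>y\<close>.\<close>
    have c_eq: "c = sup x (inf c y)"
      using c by (simp add: sup_inf_distrib1 sup.absorb2 inf.absorb1 less_imp_le)
    then have "inf x y \<noteq> inf c y"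
      using c(1) by (metis inf_le1 less_irrefl sup.absorb1)
    moreover have "inf x y \<le> inf c y"
      using c(1) by (simp add: le_infI1 less_imp_le)
    ultimately have "inf x y < inf c y"
      by (rule le_neq_trans [rotated])
    moreover have "inf c y \<noteq> y"
      using c_eq c(2) by auto
    ultimately show False
      using y by (meson inf_le2 less_le)
  qed
  from this [of b a] this [of a b] have "covers (sup a b) a" "covers (sup a b) b"
    using assms by (auto simp: sup_commute inf_commute)
  moreover have "inf a b < a" "inf a b < b"
    using assms(1,2) by (metis inf_le1 inf_le2 less_le)+
  then have "covers a (inf a b)" "covers b (inf a b)"
    using a b unfolding covers_def by blast+
  ultimately show ?thesis
    using assms(1) by (auto simp: diamond_pair_def)
qed

lemma diamond_pair_incomparable:
  fixes a b :: "'a::lattice"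
  assumes "diamond_pair a b"
  shows "\<not> a \<le> b" "\<not> b \<le> a"
  using assms by (auto simp: diamond_pair_def covers_def sup.absorb1 sup.absorb2)

section \<open>The operation \<open>\<odot>\<close> and the defect of a weight\<close>

locale join_irreducible_partition =
  fixes Uo Uc :: "'a::{finite,distrib_lattice} set"
  assumes cover: "Uo \<union> Uc = join_irreducibles"
    and disjoint: "Uo \<inter> Uc = {}"
begin

text \<open>The values are natural numbers because \<open>K a p\<close> serves as the exponent of
  the variable of \<open>p\<close> in the image of the variable of \<open>a\<close>.\<close>

definition K :: "'a \<Rightarrow> 'a \<Rightarrow> nat" where
  "K a = indicator (K_set Uo Uc (iota a))"

abbreviation dot :: "'a \<Rightarrow> 'a \<Rightarrow> 'a" where
  "dot \<equiv> odot Uo Uc"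

lemma iota_eq: "iota a = {q \<in> join_irreducibles. \<exists>p. K a p > 0 \<and> q \<le> p}"
proof -
  have "iota a \<subseteq> Uo \<union> Uc"
    by (auto simp: cover iota_def)
  from iota_eq_lower_closure_K_set [OF order_ideal_iota this] show ?thesis
    by (auto simp: K_def indicator_def)
qed

lemma K_inj:
  assumes "K a = K b"
  shows "a = b"
proof -
  have "iota a = iota b"
    by (simp add: iota_eq [of a] iota_eq [of b] assms)
  then show ?thesis
    by (simp add: iota_eq_iff)
qed

text \<open>Since \<open>iota d\<close> is contained in \<open>iota c\<close>, the support of
  \<open>K c + K d\<close> has lower closure \<open>iota c\<close>. This determines
  \<open>c\<close>, and cancelling \<open>K c\<close> leaves \<open>K d\<close>.\<close>

lemma sorted_pair_unique:
  assumes "d \<le> c" "d' \<le> c'" and eq: "\<And>p. K c p + K d p = K c' p + K d' p"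
  shows "c = c' \<and> d = d'"
proof -
  have *: "iota x = {q \<in> join_irreducibles. \<exists>p. K x p + K y p > 0 \<and> q \<le> p}" if "y \<le> x" for x y
  proof -
    have "iota x = iota x \<union> iota y"
      using that iota_subset_iff by blast
    then show ?thesis
      using iota_eq [of x] iota_eq [of y] by auto
  qed
  have "iota c = iota c'"
    using * [OF assms(1)] * [OF assms(2)] eq by simp
  then have "c = c'"
    by (simp add: iota_eq_iff)
  moreover from this eq have "K d = K d'"
    by (simp add: fun_eq_iff)
  ultimately show ?thesis
    using K_inj by blast
qed

lemma exists_complement:
  "\<exists>d. d \<le> inf a b \<and> (\<forall>p. K a p + K b p = K (sup a b) p + K d p)"
proof -
  \<comment> \<open>The identity forces \<open>M\<close> to be the set of maximal elements of the new ideal in \<open>Uc\<close>,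
    and its part in \<open>Uo\<close> to be that of \<open>iota a \<inter> iota b\<close>.\<close>
  define M where "M = {p \<in> iota a \<inter> iota b \<inter> Uc.
    (\<forall>q\<in>iota a. p \<le> q \<longrightarrow> q = p) \<or> (\<forall>q\<in>iota b. p \<le> q \<longrightarrow> q = p)}"
  define J where "J = {q \<in> join_irreducibles. \<exists>p \<in> (iota a \<inter> iota b \<inter> Uo) \<union> M. q \<le> p}"
  have oi: "order_ideal J"
    by (auto simp: order_ideal_def J_def intro: order_trans)
  then obtain d where d: "J = iota d"
    using order_ideal_imp_iota by blast
  have sub: "J \<subseteq> iota a \<inter> iota b"
    by (auto simp: J_def M_def iota_def intro: order_trans)
  then have "d \<le> inf a b"
    using d iota_subset_iff [of d "inf a b"] by (simp add: iota_inf)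
  have Uo: "J \<inter> Uo = iota a \<inter> iota b \<inter> Uo"
    using sub by (auto simp: J_def iota_def)
  have "M \<subseteq> J"
    by (auto simp: J_def M_def iota_def)
  \<comment> \<open>A maximal element of \<open>J\<close> in \<open>Uc\<close> lies below a
    generator, hence equals it, and disjointness from \<open>Uo\<close> puts it into
    \<open>M\<close>. Conversely, an element of \<open>M\<close> is maximal in \<open>iota a\<close>
    or \<open>iota b\<close>, hence in the subset \<open>J\<close>.\<close>
  have Uc: "{p \<in> J \<inter> Uc. \<forall>q\<in>J. p \<le> q \<longrightarrow> q = p} = M"
  proof (intro set_eqI iffI)
    fix p assume p: "p \<in> {p \<in> J \<inter> Uc. \<forall>q\<in>J. p \<le> q \<longrightarrow> q = p}"
    then obtain r where r: "r \<in> (iota a \<inter> iota b \<inter> Uo) \<union> M" "p \<le> r"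
      by (auto simp: J_def)
    moreover have "r \<in> J"
      using r(1) Uo \<open>M \<subseteq> J\<close> by blast
    ultimately show "p \<in> M"
      using p disjoint by auto
  next
    fix p assume "p \<in> M"
    then show "p \<in> {p \<in> J \<inter> Uc. \<forall>q\<in>J. p \<le> q \<longrightarrow> q = p}"
      using \<open>M \<subseteq> J\<close> sub by (auto simp: M_def)
  qed
  have KJ: "K_set Uo Uc J = (iota a \<inter> iota b \<inter> Uo) \<union> M"
    unfolding K_set_def Uo Uc ..
  have down: "p \<in> iota x" if "q \<in> iota x" "p \<in> join_irreducibles" "p \<le> q" for p q x :: 'a
    using that by (auto simp: iota_def)
  have jirr: "p \<in> join_irreducibles" if "p \<in> iota x" for p x :: 'a
    using that by (auto simp: iota_def)
  have "K a p + K b p = K (sup a b) p + K d p" for p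
  proof -
    let ?m = "\<lambda>x. \<forall>q\<in>iota x. p \<le> q \<longrightarrow> q = p"
    have K: "K x p = (if p \<in> iota x \<and> (p \<in> Uo \<or> p \<in> Uc \<and> ?m x) then 1 else 0)" for x
      by (auto simp: K_def indicator_def K_set_def)
    have Kd: "K d p = (if p \<in> iota a \<and> p \<in> iota b \<and> (p \<in> Uo \<or> p \<in> Uc \<and> (?m a \<or> ?m b)) then 1 else 0)"
      unfolding K_def d [symmetric] KJ by (auto simp: indicator_def M_def)
    have Ks: "K (sup a b) p =
        (if (p \<in> iota a \<or> p \<in> iota b) \<and> (p \<in> Uo \<or> p \<in> Uc \<and> ?m a \<and> ?m b) then 1 else 0)"
      by (auto simp: K iota_sup)
    \<comment> \<open>An element of \<open>iota b\<close> above \<open>p\<close> would put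
      \<open>p\<close> into \<open>iota b\<close>, so maximality with respect to
      \<open>iota b\<close> holds vacuously.\<close>
    have nb: "?m b" if "p \<in> iota a" "p \<notin> iota b"
      using that down jirr by blast
    have na: "?m a" if "p \<in> iota b" "p \<notin> iota a"
      using that down jirr by blast
    define ma mb where "ma = ?m a" and "mb = ?m b"
    have "p \<in> Uc \<Longrightarrow> p \<notin> Uo"
      using disjoint by blast
    then show ?thesis
      using na nb unfolding Kd Ks K [of a] K [of b] ma_def [symmetric] mb_def [symmetric] by auto
  qed
  with \<open>d \<le> inf a b\<close> show ?thesis by blast
qed

text \<open>Resolves the definite description behind \<open>odot\<close>:
  \<open>exists_complement\<close> supplies a witness, injectivity of \<open>K\<close> its
  uniqueness. The bound by the meet is inherited from that witness.\<close>

lemma dot_spec: "dot a b \<le> inf a b \<and> (\<forall>p. K a p + K b p = K (sup a b) p + K (dot a b) p)"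
proof -
  obtain d where d: "d \<le> inf a b" "\<And>p. K a p + K b p = K (sup a b) p + K d p"
    using exists_complement by blast
  have "odot_ideal Uo Uc (iota a) (iota b) = iota d"
    unfolding odot_ideal_def
  proof (rule the_equality)
    show "order_ideal (iota d) \<and>
        (\<forall>p. indicator (K_set Uo Uc (iota a)) p + indicator (K_set Uo Uc (iota b)) p =
             indicator (K_set Uo Uc (iota a \<union> iota b)) p
               + (indicator (K_set Uo Uc (iota d)) p :: nat))"
      using d(2) by (simp add: order_ideal_iota K_def iota_sup)
  next
    fix J' assume J': "order_ideal J' \<and>
        (\<forall>p. indicator (K_set Uo Uc (iota a)) p + indicator (K_set Uo Uc (iota b)) p =
             indicator (K_set Uo Uc (iota a \<union> iota b)) p
               + (indicator (K_set Uo Uc J') p :: nat))"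
    then obtain e where e: "J' = iota e"
      using order_ideal_imp_iota by blast
    with J' d(2) have "K d p = K e p" for p
      by (simp add: K_def iota_sup)
    then show "J' = iota d"
      using K_inj e by blast
  qed
  moreover have "inj (iota :: 'a \<Rightarrow> 'a set)"
    by (simp add: inj_def iota_eq_iff)
  ultimately have "dot a b = d"
    by (simp add: odot_def)
  with d show ?thesis by simp
qed

lemma dot_le: "dot a b \<le> inf a b"
  using dot_spec by blast

lemma K_dot: "K a p + K b p = K (sup a b) p + K (dot a b) p"
  using dot_spec by blast

lemma dot_commute: "dot a b = dot b a"
  by (simp add: odot_def odot_ideal_def Un_commute add.commute)

lemma dot_eqI:
  assumes "d \<le> c" "\<And>p. K a p + K b p = K c p + K d p"
  shows "sup a b = c" "dot a b = d"
proof -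
  have "dot a b \<le> sup a b"
    using dot_le [of a b] by (meson inf_le1 order_trans sup_ge1)
  then show "sup a b = c" "dot a b = d"
    using sorted_pair_unique [of "dot a b" "sup a b" d c] assms K_dot [of a _ b] by auto
qed

definition defect :: "(real, 'a) vec \<Rightarrow> 'a \<Rightarrow> 'a \<Rightarrow> real" where
  "defect w a b = w $ sup a b + w $ dot a b - w $ a - w $ b"

lemma defect_commute: "defect w a b = defect w b a"
  by (simp add: defect_def dot_commute [of a b] sup_commute)

lemma defect_comparable:
  assumes "a \<le> b"
  shows "defect w a b = 0"
  using dot_eqI [of a b a b] assms by (simp add: defect_def)

text \<open>Adding the exchange identities for \<open>c, b\<close> and for \<open>a, sup c b\<close>
  and subtracting the one for \<open>a, b\<close> shows that \<open>dot c b, dot a (sup c b)\<close>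
  has the same \<open>K\<close>-sum as the sorted pair \<open>c, dot a b\<close>. By uniqueness of
  sorted pairs the latter is its join and product, and the weights telescope.\<close>

lemma defect_decompose:
  assumes "inf a b \<le> c" "c \<le> a"
  shows "sup (dot c b) (dot a (sup c b)) = c"
    and "defect w a b = defect w c b + defect w a (sup c b) + defect w (dot c b) (dot a (sup c b))"
proof -
  have join: "sup a (sup c b) = sup a b"
    using assms(2) by (simp add: sup.absorb1 flip: sup.assoc)
  have "dot a b \<le> c"
    using dot_le assms(1) order_trans by blast
  moreover have "K (dot c b) p + K (dot a (sup c b)) p = K c p + K (dot a b) p" for p
    using K_dot [of c p b] K_dot [of a p "sup c b"] K_dot [of a p b] by (simp add: join)
  ultimately have eq: "sup (dot c b) (dot a (sup c b)) = c"
      "dot (dot c b) (dot a (sup c b)) = dot a b"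
    by (rule dot_eqI)+
  show "sup (dot c b) (dot a (sup c b)) = c"
    by (fact eq)
  show "defect w a b = defect w c b + defect w a (sup c b) + defect w (dot c b) (dot a (sup c b))"
    by (simp add: defect_def join eq)
qed

text \<open>Lexicographic induction, first on the rank of the join, then on the corank of the meet.
  A pair with nothing strictly between its meet and either member is a diamond pair; otherwise the
  defect is decomposed.\<close>

lemma defect_pos:
  assumes diamond: "\<And>a b. diamond_pair a b \<Longrightarrow> defect w a b > 0"
  shows "\<not> a \<le> b \<Longrightarrow> \<not> b \<le> a \<Longrightarrow> defect w a b > 0"
proof (induction "(card (iota (sup a b)), card (UNIV - iota (inf a b)))" arbitrary: a b
    rule: wf_induct_rule [OF wf_lex_prod [OF wf_less_than wf_less_than]])
  case (1 a b)
  have card_less: "card (iota x) < card (iota y)" if "x < y" for x y :: 'a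
    using that by (intro psubset_card_mono) (auto simp: psubset_eq iota_subset_iff iota_eq_iff)
  have cocard_less: "card (UNIV - iota y) < card (UNIV - iota x)" if "x < y" for x y :: 'a
  proof -
    have "iota x \<subset> iota y"
      using that by (auto simp: psubset_eq iota_subset_iff iota_eq_iff)
    then show ?thesis
      by (intro psubset_card_mono) auto
  qed
  have IH1: "defect w x y > 0"
    if "\<not> x \<le> y" "\<not> y \<le> x" "sup x y < sup a b" for x y
    using 1(1) [of x y] that card_less by auto
  have IH2: "defect w x y > 0"
    if "\<not> x \<le> y" "\<not> y \<le> x" "sup x y = sup a b" "inf a b < inf x y" for x y
    using 1(1) [of x y] that cocard_less by auto
  have step: "defect w x y > 0"
    if xy: "\<not> x \<le> y" "\<not> y \<le> x" "sup x y = sup a b" "inf x y = inf a b"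
      and c: "inf x y < c" "c < x" for x y c
  proof -
    \<comment> \<open>The first summand has a smaller join, the second the same join and a larger meet, the third
      the join \<open>c\<close>.\<close>
    note eq = defect_decompose [of x y c, OF less_imp_le [OF c(1)] less_imp_le [OF c(2)]]
    have meet: "inf x (sup c y) = c"
      using c by (simp add: inf_sup_distrib1 inf.absorb2 sup.absorb1 less_imp_le)
    have nle: "\<not> x \<le> sup c y"
      using meet c(2) by (metis inf.absorb1 less_irrefl)
    have ncy: "\<not> c \<le> y"
      using c by (meson le_infI less_imp_le leD)
    have nyc: "\<not> y \<le> c"
      using c(2) xy(2) by (meson less_imp_le order_trans)
    have lt: "sup c y < sup x y"
      using c(2) nle by (metis le_sup_iff less_le less_imp_le order_refl sup_mono)
    have "defect w c y > 0"
      using IH1 ncy nyc lt xy(3) by metis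
    moreover have "defect w x (sup c y) > 0"
    proof (rule IH2)
      show "sup x (sup c y) = sup a b"
        using c(2) xy(3) by (metis less_imp_le sup.absorb1 sup.assoc)
      show "\<not> sup c y \<le> x" using xy(2) by simp
      show "inf a b < inf x (sup c y)" using c(1) xy(4) meet by simp
    qed (fact nle)
    \<comment> \<open>Only nonnegativity is claimed, since these two elements may be comparable and
      then have defect zero.\<close>
    moreover have "defect w (dot c y) (dot x (sup c y)) \<ge> 0"
    proof (cases "dot c y \<le> dot x (sup c y) \<or> dot x (sup c y) \<le> dot c y")
      case True
      then show ?thesis
        using defect_comparable defect_commute by (metis order_refl)
    next
      case False
      have "c < sup a b"
        using c(2) xy(3) by (metis less_le_trans sup_ge1)
      with False show ?thesis
        using IH1 [of "dot c y" "dot x (sup c y)"] eq(1) by simp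
    qed
    ultimately show ?thesis
      using eq(2) [of w] by linarith
  qed
  show ?case
  proof (cases "\<exists>c. inf a b < c \<and> (c < a \<or> c < b)")
    case True
    then show ?thesis
      using step [of a b] step [of b a] 1(2,3) defect_commute
      by (metis inf_commute sup_commute)
  next
    case False
    then show ?thesis
      using diamond_pairI [of a b] 1(2,3) diamond by blast
  qed
qed

end

section \<open>Products of monomials and coefficients of polynomials\<close>

lemma single_power:
  "Poly_Mapping.single m (1::'r::comm_semiring_1) ^ n
     = Poly_Mapping.single (\<Sum>i<n. (m :: 'v \<Rightarrow>\<^sub>0 nat)) 1"
  by (induction n) (simp_all add: mult_single add.commute)

lemma prod_single:
  "(\<Prod>x\<in>A. Poly_Mapping.single (f x) (1::'r::comm_semiring_1))
     = Poly_Mapping.single (\<Sum>x\<in>A. (f x :: 'v \<Rightarrow>\<^sub>0 nat)) 1"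
  by (induction A rule: infinite_finite_induct) (simp_all add: mult_single)

lemma poly_mapping_eq_sum_single:
  "f = (\<Sum>m\<in>Poly_Mapping.keys f. Poly_Mapping.single m (Poly_Mapping.lookup f m))"
proof (rule poly_mapping_eqI)
  fix k
  show "Poly_Mapping.lookup f k
    = Poly_Mapping.lookup (\<Sum>m\<in>Poly_Mapping.keys f. Poly_Mapping.single m (Poly_Mapping.lookup f m)) k"
    by (simp add: lookup_sum lookup_single when_def in_keys_iff)
qed

lemma Var_mult_Var:
  "Var a * Var b = Poly_Mapping.single (Poly_Mapping.single a 1 + Poly_Mapping.single b 1) 1"
  by (simp add: Var_def mult_single)

lemma cscale_single: "cscale c (Poly_Mapping.single m d) = Poly_Mapping.single m (c * d)"
  by (simp add: cscale_def Const_def mult_single)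

lemma lookup_cscale: "Poly_Mapping.lookup (cscale c f) m = c * Poly_Mapping.lookup f m"
proof -
  have "cscale c f = (\<Sum>m\<in>Poly_Mapping.keys f. Poly_Mapping.single m (c * Poly_Mapping.lookup f m))"
    by (subst poly_mapping_eq_sum_single [of f]) (simp add: cpoly.scale_sum_right cscale_single)
  then show ?thesis
    by (simp add: lookup_sum lookup_single when_def in_keys_iff)
qed

section \<open>Weights and initial forms\<close>

lemma weight_add: "weight w (m + n) = weight w m + weight w n"
  by (simp add: weight_def lookup_add distrib_right sum.distrib)

lemma weight_single: "weight w (Poly_Mapping.single a 1) = w $ a"
  by (simp add: weight_def lookup_single when_def if_distrib if_distribR cong: if_cong)

lemma lookup_initial_form:
  "Poly_Mapping.lookup (initial_form w f) m =
     (if \<forall>m'\<in>Poly_Mapping.keys f. weight w m \<le> weight w m' then Poly_Mapping.lookup f m else 0)"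
  by (auto simp: initial_form_def lookup_sum lookup_single when_def in_keys_iff)

lemma keys_binomial:
  assumes "m \<noteq> n"
  shows "Poly_Mapping.keys (Poly_Mapping.single m 1 - Poly_Mapping.single n (1::complex)) = {m, n}"
  using assms by (auto simp: in_keys_iff lookup_minus lookup_single when_def split: if_splits)

lemma initial_form_binomial:
  assumes "weight w m < weight w n"
  shows "initial_form w (Poly_Mapping.single m 1 - Poly_Mapping.single n 1) = Poly_Mapping.single m 1"
proof (rule poly_mapping_eqI)
  have "m \<noteq> n"
    using assms by auto
  note keys_binomial [OF this]
  then show "Poly_Mapping.lookup
      (initial_form w (Poly_Mapping.single m 1 - Poly_Mapping.single n 1)) k
      = Poly_Mapping.lookup (Poly_Mapping.single m 1) k" for k
    using assms \<open>m \<noteq> n\<close> unfolding lookup_initial_form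
    by (auto simp: lookup_minus lookup_single when_def)
qed

section \<open>Chain monomials\<close>

definition chain_monomial :: "'a::order monomial \<Rightarrow> bool" where
  "chain_monomial m \<longleftrightarrow> (\<forall>a\<in>Poly_Mapping.keys m. \<forall>b\<in>Poly_Mapping.keys m. a \<le> b \<or> b \<le> a)"

lemma keys_add_nat: "Poly_Mapping.keys (m + n :: 'v monomial) = Poly_Mapping.keys m \<union> Poly_Mapping.keys n"
  by (auto simp: in_keys_iff lookup_add)

lemma chain_monomial_add: "chain_monomial (m + n) \<Longrightarrow> chain_monomial m"
  by (auto simp: chain_monomial_def keys_add_nat)

lemma monomial_split_single:
  assumes "a \<in> Poly_Mapping.keys m"
  shows "m = Poly_Mapping.single a 1 + (m - Poly_Mapping.single a (1::nat))"
  using assms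
  by (intro poly_mapping_eqI)
    (auto simp: lookup_add lookup_minus lookup_single when_def in_keys_iff)

lemma not_chain_monomialE:
  assumes "\<not> chain_monomial m"
  obtains a b n where "\<not> a \<le> b" "\<not> b \<le> a"
    "m = n + (Poly_Mapping.single a 1 + Poly_Mapping.single b 1)"
proof -
  obtain a b where ab: "a \<in> Poly_Mapping.keys m" "b \<in> Poly_Mapping.keys m" "\<not> a \<le> b" "\<not> b \<le> a"
    using assms by (auto simp: chain_monomial_def)
  let ?n = "m - Poly_Mapping.single a 1"
  have "b \<in> Poly_Mapping.keys ?n"
    using ab by (auto simp: in_keys_iff lookup_minus lookup_single when_def)
  then have "m = Poly_Mapping.single a 1 + (Poly_Mapping.single b 1 + (?n - Poly_Mapping.single b 1))"
    using monomial_split_single [OF ab(1)] monomial_split_single by metis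
  then show thesis
    using ab that [of a b "?n - Poly_Mapping.single b 1"] by (simp add: ac_simps)
qed

text \<open>A monomial is a multiple of a generator exactly when it is not a chain monomial, and
  factors of chain monomials are chain monomials. Membership in the ideal thereby becomes a
  condition on the support.\<close>

lemma monomial_ideal_eq:
  "monomial_ideal = {f. \<forall>m\<in>Poly_Mapping.keys f. \<not> chain_monomial m}" (is "_ = ?N")
proof
  let ?G = "{Var a * Var b | a b :: 'a. \<not> a \<le> b \<and> \<not> b \<le> a}"
  show "monomial_ideal \<subseteq> ?N"
    unfolding monomial_ideal_def
  proof (rule ideal.span_minimal)
    show "?G \<subseteq> ?N"
    proof clarify
      fix a b :: 'a and m
      assume ab: "\<not> a \<le> b" "\<not> b \<le> a" and "m \<in> Poly_Mapping.keys (Var a * Var b)"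
        and chain: "chain_monomial m"
      then have "m = Poly_Mapping.single a 1 + Poly_Mapping.single b 1"
        by (auto simp: Var_mult_Var split: if_splits)
      with chain ab show False
        by (auto simp: chain_monomial_def keys_add_nat)
    qed
    show "ideal.subspace ?N"
      unfolding ideal.subspace_def
    proof (intro conjI ballI allI)
      fix f g assume "f \<in> ?N" "g \<in> ?N"
      then show "f + g \<in> ?N"
        using Poly_Mapping.keys_add [of f g] by blast
    next
      fix c f assume f: "f \<in> ?N"
      show "c * f \<in> ?N"
      proof clarify
        fix m assume m: "m \<in> Poly_Mapping.keys (c * f)" "chain_monomial m"
        then obtain k l where "m = k + l" "l \<in> Poly_Mapping.keys f"
          using keys_mult [of c f] by auto
        with m f show False
          using chain_monomial_add [of l k] by (simp add: add.commute)
      qed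
    qed simp
  qed
  show "?N \<subseteq> monomial_ideal"
  proof
    fix f assume f: "f \<in> ?N"
    have "Poly_Mapping.single m c \<in> monomial_ideal" if "\<not> chain_monomial m" for m :: "'a monomial" and c
    proof -
      obtain a b n where ab: "\<not> a \<le> b" "\<not> b \<le> a"
        "m = n + (Poly_Mapping.single a 1 + Poly_Mapping.single b 1)"
        using not_chain_monomialE [OF \<open>\<not> chain_monomial m\<close>] by metis
      then have "Poly_Mapping.single m c = Poly_Mapping.single n c * (Var a * Var b)"
        by (simp add: Var_mult_Var mult_single)
      moreover have "Var a * Var b \<in> ideal_generated ?G"
        using ab by (intro ideal.span_base) auto
      ultimately show ?thesis
        unfolding monomial_ideal_def by (simp only: ideal.span_scale)
    qed
    then have "(\<Sum>m\<in>Poly_Mapping.keys f. Poly_Mapping.single m (Poly_Mapping.lookup f m)) \<in> monomial_ideal"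
      using f unfolding monomial_ideal_def by (intro ideal.span_sum) auto
    then show "f \<in> monomial_ideal"
      using poly_mapping_eq_sum_single [of f] by simp
  qed
qed

text \<open>Each exponent is at most \<open>n\<close>. All monomials in a fibre of the monomial map
  share their degree, so a heaviest one can be chosen there.\<close>

lemma finite_monomials_of_degree:
  "finite {m :: 'a::finite monomial. (\<Sum>a\<in>UNIV. Poly_Mapping.lookup m a) = n}"
proof (rule finite_imageD)
  have "Poly_Mapping.lookup m a \<le> n" if "(\<Sum>a\<in>UNIV. Poly_Mapping.lookup m a) = n" for m :: "'a monomial" and a
    using that member_le_sum [of a UNIV "Poly_Mapping.lookup m"] by simp
  then have "Poly_Mapping.lookup ` {m :: 'a monomial. (\<Sum>a\<in>UNIV. Poly_Mapping.lookup m a) = n}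
      \<subseteq> PiE UNIV (\<lambda>_. {..n})"
    by (auto simp: PiE_def)
  then show "finite (Poly_Mapping.lookup ` {m :: 'a monomial. (\<Sum>a\<in>UNIV. Poly_Mapping.lookup m a) = n})"
    by (rule finite_subset) (simp add: finite_PiE)
qed (simp add: inj_on_def)

section \<open>Fibres of the monomial map\<close>

context join_irreducible_partition
begin

text \<open>The exponent vector of the image of a monomial under \<open>hibi_map\<close>; the
  constant sum over \<open>i\<close> encodes multiplicity. The coordinate \<open>None\<close>
  records the degree.\<close>

definition image_exponent :: "'a monomial \<Rightarrow> 'a option monomial" where
  "image_exponent m = (\<Sum>v\<in>Poly_Mapping.keys m. \<Sum>i<Poly_Mapping.lookup m v.
     Poly_Mapping.single None 1 + (\<Sum>p\<in>K_set Uo Uc (iota v). Poly_Mapping.single (Some p) 1))"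

lemma lookup_image_exponent:
  "Poly_Mapping.lookup (image_exponent m) x =
     (\<Sum>v\<in>UNIV. Poly_Mapping.lookup m v * (case x of None \<Rightarrow> 1 | Some p \<Rightarrow> K v p))"
proof -
  have "Poly_Mapping.lookup (image_exponent m) x =
     (\<Sum>v\<in>Poly_Mapping.keys m. Poly_Mapping.lookup m v * (case x of None \<Rightarrow> 1 | Some p \<Rightarrow> K v p))"
    unfolding image_exponent_def
    by (auto simp: lookup_sum lookup_add lookup_single when_def K_def indicator_def
        split: option.splits intro!: sum.cong)
  then show ?thesis
    by (simp add: sum.mono_neutral_left in_keys_iff)
qed

lemma image_exponent_eq_iff:
  "image_exponent m = image_exponent n \<longleftrightarrow>
     (\<Sum>v\<in>UNIV. Poly_Mapping.lookup m v) = (\<Sum>v\<in>UNIV. Poly_Mapping.lookup n v) \<and>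
     (\<forall>p. (\<Sum>v\<in>UNIV. Poly_Mapping.lookup m v * K v p) = (\<Sum>v\<in>UNIV. Poly_Mapping.lookup n v * K v p))"
  by (simp add: poly_mapping_eq_iff fun_eq_iff lookup_image_exponent split_option_all
      del: lookup_inject)

lemma image_exponent_add: "image_exponent (m + n) = image_exponent m + image_exponent n"
  by (rule poly_mapping_eqI) (simp add: lookup_image_exponent lookup_add distrib_right sum.distrib)

lemma image_exponent_swap:
  "image_exponent (n + (Poly_Mapping.single a 1 + Poly_Mapping.single b 1)) =
   image_exponent (n + (Poly_Mapping.single (sup a b) 1 + Poly_Mapping.single (dot a b) 1))"
proof -
  have "(\<Sum>v\<in>UNIV. Poly_Mapping.lookup (Poly_Mapping.single a 1) v * f v) = f a" for a and f :: "'a \<Rightarrow> nat"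
    by (simp add: lookup_single when_def if_distrib if_distribR cong: if_cong)
  then have "image_exponent (Poly_Mapping.single a 1 + Poly_Mapping.single b 1) =
      image_exponent (Poly_Mapping.single (sup a b) 1 + Poly_Mapping.single (dot a b) 1)"
    using K_dot [of a _ b]
    by (intro poly_mapping_eqI)
      (simp add: lookup_image_exponent lookup_add distrib_right sum.distrib split: option.splits)
  then show ?thesis
    by (simp only: image_exponent_add)
qed

lemma hibi_map_eq:
  "hibi_map Uo Uc f =
     (\<Sum>m\<in>Poly_Mapping.keys f. Poly_Mapping.single (image_exponent m) (Poly_Mapping.lookup f m))"
  by (simp add: hibi_map_def poly_subst_def Var_def prod_single mult_single single_power
      image_exponent_def Const_def)

text \<open>The map sends monomials to monomials, so a coefficient of the image is the sum of the
  coefficients over one fibre.\<close>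

lemma hibi_ideal_iff:
  "f \<in> hibi_ideal Uo Uc \<longleftrightarrow>
     (\<forall>e. (\<Sum>m | m \<in> Poly_Mapping.keys f \<and> image_exponent m = e. Poly_Mapping.lookup f m) = 0)"
proof -
  have "Poly_Mapping.lookup (hibi_map Uo Uc f) e =
      (\<Sum>m | m \<in> Poly_Mapping.keys f \<and> image_exponent m = e. Poly_Mapping.lookup f m)" for e
    by (simp add: hibi_map_eq lookup_sum lookup_single when_def sum.inter_filter)
  then show ?thesis
    by (simp add: hibi_ideal_def poly_mapping_eq_iff fun_eq_iff del: lookup_inject)
qed

lemma binomial_in_hibi_ideal:
  assumes "image_exponent m = image_exponent n"
  shows "Poly_Mapping.single m 1 - Poly_Mapping.single n 1 \<in> hibi_ideal Uo Uc"
proof (cases "m = n")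
  case True
  then show ?thesis
    by (simp add: hibi_ideal_iff)
next
  case False
  let ?f = "Poly_Mapping.single m 1 - Poly_Mapping.single n (1::complex)"
  note keys = keys_binomial [OF False]
  have "(\<Sum>k | k \<in> Poly_Mapping.keys ?f \<and> image_exponent k = e. Poly_Mapping.lookup ?f k) = 0" for e
  proof (cases "e = image_exponent m")
    case True
    then have "{k. k \<in> Poly_Mapping.keys ?f \<and> image_exponent k = e} = {m, n}"
      using keys assms by auto
    then show ?thesis
      using False by (simp add: lookup_minus lookup_single when_def)
  next
    case e: False
    then have "{k. k \<in> Poly_Mapping.keys ?f \<and> image_exponent k = e} = {}"
      using keys assms by auto
    then show ?thesis
      by (simp only: sum.empty)
  qed
  then show ?thesis
    by (simp add: hibi_ideal_iff)
qed

text \<open>The largest variable \<open>c\<close> has an order ideal containing those of all other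
  factors. The set on the right depends on \<open>m\<close> only through its image, so monomials
  with equal images have equal largest variables.\<close>

lemma chain_monomial_top:
  assumes "chain_monomial m" "m \<noteq> 0"
  obtains c where "c \<in> Poly_Mapping.keys m"
    "iota c = {q \<in> join_irreducibles. \<exists>p. (\<Sum>v\<in>UNIV. Poly_Mapping.lookup m v * K v p) > 0 \<and> q \<le> p}"
proof -
  have "finite (Poly_Mapping.keys m)" "Poly_Mapping.keys m \<noteq> {}"
    using assms(2) by auto
  then obtain c where c: "c \<in> Poly_Mapping.keys m" "\<forall>x\<in>Poly_Mapping.keys m. c \<le> x \<longrightarrow> c = x"
    using finite_has_maximal by metis
  then have top: "x \<le> c" if "x \<in> Poly_Mapping.keys m" for x
    using that assms(1) by (auto simp: chain_monomial_def)
  have pos: "(\<Sum>v\<in>UNIV. Poly_Mapping.lookup m v * K v p) > 0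
      \<longleftrightarrow> (\<exists>v\<in>Poly_Mapping.keys m. K v p > 0)" for p
    by (auto simp: in_keys_iff simp flip: neq0_conv)
  have "iota c = (\<Union>v\<in>Poly_Mapping.keys m. iota v)"
    using c(1) top iota_subset_iff by blast
  also have "\<dots> = {q \<in> join_irreducibles. \<exists>p. (\<exists>v\<in>Poly_Mapping.keys m. K v p > 0) \<and> q \<le> p}"
    using iota_eq by auto
  finally show thesis
    using that [OF c(1)] by (simp only: pos)
qed

text \<open>Induction on the degree: the largest variables agree by
  \<open>chain_monomial_top\<close> and can be cancelled.\<close>

lemma chain_monomial_unique:
  assumes "chain_monomial m" "chain_monomial n" "image_exponent m = image_exponent n"
  shows "m = n"
  using assms
proof (induction "\<Sum>v\<in>UNIV. Poly_Mapping.lookup m v" arbitrary: m n)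
  case 0
  then have "(\<Sum>v\<in>UNIV. Poly_Mapping.lookup m v) = 0" "(\<Sum>v\<in>UNIV. Poly_Mapping.lookup n v) = 0"
    by (simp_all add: image_exponent_eq_iff)
  then show ?case
    by (auto intro!: poly_mapping_eqI)
next
  case (Suc k)
  have "m \<noteq> 0" "n \<noteq> 0"
    using Suc(2) Suc.prems(3) by (auto simp: image_exponent_eq_iff)
  obtain c where c: "c \<in> Poly_Mapping.keys m"
    "iota c = {q \<in> join_irreducibles. \<exists>p. (\<Sum>v\<in>UNIV. Poly_Mapping.lookup m v * K v p) > 0 \<and> q \<le> p}"
    using chain_monomial_top [OF Suc.prems(1) \<open>m \<noteq> 0\<close>] .
  obtain d where d: "d \<in> Poly_Mapping.keys n"
    "iota d = {q \<in> join_irreducibles. \<exists>p. (\<Sum>v\<in>UNIV. Poly_Mapping.lookup n v * K v p) > 0 \<and> q \<le> p}"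
    using chain_monomial_top [OF Suc.prems(2) \<open>n \<noteq> 0\<close>] .
  have "iota c = iota d"
    using Suc.prems(3) by (simp add: c(2) d(2) image_exponent_eq_iff)
  then have "c = d"
    by (simp add: iota_eq_iff)
  let ?x = "Poly_Mapping.single c (1::nat)"
  obtain m' where m: "m = m' + ?x"
    using monomial_split_single [OF c(1)] by (metis add.commute)
  obtain n' where n: "n = n' + ?x"
    using monomial_split_single [OF d(1)] \<open>c = d\<close> by (metis add.commute)
  have "m' = n'"
  proof (rule Suc(1))
    have "(\<Sum>v\<in>UNIV. Poly_Mapping.lookup ?x v) = 1"
      by (simp add: lookup_single when_def)
    then show "k = (\<Sum>v\<in>UNIV. Poly_Mapping.lookup m' v)"
      using Suc(2) by (simp add: m lookup_add sum.distrib)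
    show "chain_monomial m'" "chain_monomial n'"
      using Suc.prems(1,2) unfolding m n by (auto dest: chain_monomial_add)
    show "image_exponent m' = image_exponent n'"
      using Suc.prems(3) by (simp add: m n image_exponent_add)
  qed
  then show ?case
    by (simp add: m n)
qed

section \<open>Weights on fibres and the initial ideal\<close>

lemma swap_increases_weight:
  assumes "\<And>a b. \<not> a \<le> b \<Longrightarrow> \<not> b \<le> a \<Longrightarrow> defect w a b > 0" and "\<not> chain_monomial m"
  obtains n where "image_exponent n = image_exponent m" "weight w m < weight w n"
proof -
  obtain a b k where ab: "\<not> a \<le> b" "\<not> b \<le> a"
    "m = k + (Poly_Mapping.single a 1 + Poly_Mapping.single b 1)"
    using not_chain_monomialE [OF assms(2)] by metis
  then show thesis
    using image_exponent_swap [of k a b] assms(1) [of a b]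
    by (intro that [of "k + (Poly_Mapping.single (sup a b) 1 + Poly_Mapping.single (dot a b) 1)"])
      (auto simp: weight_add weight_single defect_def simp del: One_nat_def)
qed

lemma weight_less_chain_monomial:
  assumes w: "\<And>a b. \<not> a \<le> b \<Longrightarrow> \<not> b \<le> a \<Longrightarrow> defect w a b > 0"
    and "chain_monomial n" "image_exponent m = image_exponent n" "m \<noteq> n"
  shows "weight w m < weight w n"
proof -
  let ?F = "{k. image_exponent k = image_exponent n}"
  have "finite ?F"
    by (rule finite_subset [OF _ finite_monomials_of_degree]) (auto simp: image_exponent_eq_iff)
  moreover have "?F \<noteq> {}"
    by blast
  ultimately have "\<exists>k\<in>?F. \<forall>l\<in>?F. weight w l \<le> weight w k"
    using ex_is_arg_min_if_finite [of ?F "\<lambda>k. - weight w k"] by (auto simp: is_arg_min_linorder)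
  then obtain k where k: "k \<in> ?F" "\<And>l. l \<in> ?F \<Longrightarrow> weight w l \<le> weight w k"
    by blast
  \<comment> \<open>A swap would produce something heavier than the maximum. Stating this for every
    monomial as heavy as \<open>k\<close> also excludes ties, which gives the strict
    inequality.\<close>
  have chain: "chain_monomial l" if "l \<in> ?F" "weight w k \<le> weight w l" for l
    using swap_increases_weight [OF w, of l] that k by (metis (mono_tags, lifting) leD mem_Collect_eq order_trans)
  have "k = n"
    using chain [OF k(1)] k(1) assms(2) chain_monomial_unique by blast
  moreover have "\<not> chain_monomial m"
    using assms(2-4) chain_monomial_unique by blast
  ultimately show ?thesis
    using chain [of m] assms(3) by fastforce
qed

lemma initial_ideal_eq_monomial_ideal:
  assumes w: "\<And>a b. \<not> a \<le> b \<Longrightarrow> \<not> b \<le> a \<Longrightarrow> defect w a b > 0"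
  shows "initial_ideal w (hibi_ideal Uo Uc) = monomial_ideal"
proof
  let ?N = "{f :: 'a cpoly. \<forall>m\<in>Poly_Mapping.keys f. \<not> chain_monomial m}"
  have "initial_form w f \<in> ?N" if f: "f \<in> hibi_ideal Uo Uc" for f
  proof clarify
    fix n assume "n \<in> Poly_Mapping.keys (initial_form w f)" and n: "chain_monomial n"
    then have min: "\<And>m. m \<in> Poly_Mapping.keys f \<Longrightarrow> weight w n \<le> weight w m"
      and nf: "Poly_Mapping.lookup f n \<noteq> 0"
      by (auto simp: in_keys_iff lookup_initial_form split: if_splits)
    \<comment> \<open>The chain monomial is the strictly heaviest in its fibre, yet \<open>n\<close>
      has minimal weight in \<open>f\<close>. So \<open>n\<close> is alone in its fibre and its
      nonzero coefficient cannot cancel.\<close>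
    have "m = n" if "m \<in> Poly_Mapping.keys f" "image_exponent m = image_exponent n" for m
      using weight_less_chain_monomial [OF w n that(2)] min [OF that(1)] by fastforce
    then have "{m. m \<in> Poly_Mapping.keys f \<and> image_exponent m = image_exponent n} = {n}"
      using nf by (auto simp: in_keys_iff)
    moreover have "(\<Sum>m | m \<in> Poly_Mapping.keys f \<and> image_exponent m = image_exponent n.
        Poly_Mapping.lookup f m) = 0"
      using f unfolding hibi_ideal_iff by blast
    ultimately show False
      using nf by simp
  qed
  moreover have "cpoly.subspace ?N"
    unfolding cpoly.subspace_def
  proof (intro conjI ballI allI)
    fix f g assume "f \<in> ?N" "g \<in> ?N"
    then show "f + g \<in> ?N"
      using Poly_Mapping.keys_add [of f g] by blast
  next
    fix c f assume "f \<in> ?N"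
    then show "cscale c f \<in> ?N"
      by (auto simp: in_keys_iff lookup_cscale)
  qed simp
  ultimately show "initial_ideal w (hibi_ideal Uo Uc) \<subseteq> monomial_ideal"
    unfolding initial_ideal_def monomial_ideal_eq by (intro cpoly.span_minimal) auto
  show "monomial_ideal \<subseteq> initial_ideal w (hibi_ideal Uo Uc)"
  proof
    fix f :: "'a cpoly" assume "f \<in> monomial_ideal"
    then have f: "\<And>m. m \<in> Poly_Mapping.keys f \<Longrightarrow> \<not> chain_monomial m"
      by (simp add: monomial_ideal_eq)
    \<comment> \<open>A non-chain monomial is the initial form of its difference with the heavier
      monomial obtained by a swap.\<close>
    have "Poly_Mapping.single m 1 \<in> initial_form w ` hibi_ideal Uo Uc" if "\<not> chain_monomial m" for m
    proof -
      obtain n where "image_exponent n = image_exponent m" "weight w m < weight w n"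
        using swap_increases_weight [OF w \<open>\<not> chain_monomial m\<close>] by metis
      then show ?thesis
        using initial_form_binomial binomial_in_hibi_ideal by (metis image_eqI)
    qed
    then have "cscale (Poly_Mapping.lookup f m) (Poly_Mapping.single m 1)
        \<in> initial_ideal w (hibi_ideal Uo Uc)" if "m \<in> Poly_Mapping.keys f" for m
      unfolding initial_ideal_def using f that by (intro cpoly.span_scale cpoly.span_base) auto
    then have "(\<Sum>m\<in>Poly_Mapping.keys f. Poly_Mapping.single m (Poly_Mapping.lookup f m))
        \<in> initial_ideal w (hibi_ideal Uo Uc)"
      unfolding initial_ideal_def by (intro cpoly.span_sum) (auto simp: cscale_single)
    then show "f \<in> initial_ideal w (hibi_ideal Uo Uc)"
      using poly_mapping_eq_sum_single [of f] by simp
  qed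
qed

text \<open>If the defect is zero or negative, the initial form of the exchange binomial retains the
  chain monomial \<open>?n\<close>, which cannot occur in an element of
  \<open>monomial_ideal\<close>.\<close>

lemma defect_pos_of_initial_ideal:
  assumes eq: "initial_ideal w (hibi_ideal Uo Uc) = monomial_ideal"
    and ab: "\<not> a \<le> b" "\<not> b \<le> a"
  shows "defect w a b > 0"
proof (rule ccontr)
  assume neg: "\<not> defect w a b > 0"
  let ?m = "Poly_Mapping.single a (1::nat) + Poly_Mapping.single b 1"
    and ?n = "Poly_Mapping.single (sup a b) (1::nat) + Poly_Mapping.single (dot a b) 1"
  let ?f = "Poly_Mapping.single ?m 1 - Poly_Mapping.single ?n (1::complex)"
  have chain: "chain_monomial ?n"
    using dot_le [of a b]
    by (auto simp: chain_monomial_def keys_add_nat le_supI1)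
  have "\<not> chain_monomial ?m"
    using ab by (auto simp: chain_monomial_def keys_add_nat)
  with chain have "?m \<noteq> ?n" by metis
  then have "Poly_Mapping.lookup ?f ?n = -1"
    by (simp add: lookup_minus lookup_single when_def)
  moreover have "Poly_Mapping.keys ?f = {?m, ?n}"
    using \<open>?m \<noteq> ?n\<close> by (rule keys_binomial)
  moreover have "weight w ?n \<le> weight w ?m"
    using neg by (simp add: weight_add weight_single defect_def del: One_nat_def)
  ultimately have "Poly_Mapping.lookup (initial_form w ?f) ?n = -1"
    unfolding lookup_initial_form by auto
  then have "?n \<in> Poly_Mapping.keys (initial_form w ?f)"
    by (simp add: in_keys_iff)
  moreover have "?f \<in> hibi_ideal Uo Uc"
    using binomial_in_hibi_ideal image_exponent_swap [of 0 a b] by simp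
  then have "initial_form w ?f \<in> monomial_ideal"
    unfolding eq [symmetric] initial_ideal_def by (intro cpoly.span_base imageI)
  ultimately show False
    using chain by (auto simp: monomial_ideal_eq)
qed

lemma groebner_cone_eq:
  "groebner_cone (hibi_ideal Uo Uc) monomial_ideal = {w. \<forall>a b. diamond_pair a b \<longrightarrow> defect w a b > 0}"
proof (intro set_eqI iffI)
  fix w assume "w \<in> groebner_cone (hibi_ideal Uo Uc) monomial_ideal"
  then show "w \<in> {w. \<forall>a b. diamond_pair a b \<longrightarrow> defect w a b > 0}"
    unfolding groebner_cone_def
    by (blast intro: defect_pos_of_initial_ideal dest: diamond_pair_incomparable)
next
  fix w assume "w \<in> {w. \<forall>a b. diamond_pair a b \<longrightarrow> defect w a b > 0}"
  then show "w \<in> groebner_cone (hibi_ideal Uo Uc) monomial_ideal"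
    using initial_ideal_eq_monomial_ideal [OF defect_pos] by (auto simp: groebner_cone_def)
qed

end

section \<open>Facets of the cone\<close>

text \<open>Adding a small positive multiple of \<open>w0\<close> moves a point satisfying the weak
  inequalities into the strict cone.\<close>

lemma closure_strict_halfspaces:
  fixes V :: "'e::euclidean_space set"
  assumes "\<And>v. v \<in> V \<Longrightarrow> v \<bullet> w0 > 0"
  shows "closure {w. \<forall>v\<in>V. v \<bullet> w > 0} = {w. \<forall>v\<in>V. v \<bullet> w \<ge> 0}"
proof
  have eq: "{w. \<forall>v\<in>V. v \<bullet> w \<ge> 0} = (\<Inter>v\<in>V. {w. v \<bullet> w \<ge> 0})"
    by auto
  have "closed {w. \<forall>v\<in>V. v \<bullet> w \<ge> 0}"
    unfolding eq by (intro closed_INT ballI closed_halfspace_ge)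
  then show "closure {w. \<forall>v\<in>V. v \<bullet> w > 0} \<subseteq> {w. \<forall>v\<in>V. v \<bullet> w \<ge> 0}"
    by (intro closure_minimal) (auto intro: less_imp_le)
  show "{w. \<forall>v\<in>V. v \<bullet> w \<ge> 0} \<subseteq> closure {w. \<forall>v\<in>V. v \<bullet> w > 0}"
  proof
    fix w assume w: "w \<in> {w. \<forall>v\<in>V. v \<bullet> w \<ge> 0}"
    have "(\<lambda>n. w + inverse (real (Suc n)) *\<^sub>R w0) \<longlonglongrightarrow> w + 0 *\<^sub>R w0"
      by (intro tendsto_intros LIMSEQ_inverse_real_of_nat)
    moreover have "w + inverse (real (Suc n)) *\<^sub>R w0 \<in> {w. \<forall>v\<in>V. v \<bullet> w > 0}" for n
      using w assms by (auto simp: inner_add_right intro!: add_nonneg_pos)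
    ultimately show "w \<in> closure {w. \<forall>v\<in>V. v \<bullet> w > 0}"
      unfolding closure_sequential by (metis (no_types, lifting) add.right_neutral scaleR_zero_left)
  qed
qed

text \<open>The point \<open>w0\<close> makes the cone full-dimensional. Near \<open>w1\<close> only
  the constraint of \<open>u\<close> is active, so the face contains a relatively open piece of its
  hyperplane and has codimension one.\<close>

lemma facet_of_halfspace_intersection:
  fixes V :: "'e::euclidean_space set"
  assumes "finite V" and u: "u \<in> V" "u \<noteq> 0"
    and w0: "\<And>v. v \<in> V \<Longrightarrow> v \<bullet> w0 > 0"
    and w1: "u \<bullet> w1 = 0" "\<And>v. v \<in> V \<Longrightarrow> v \<noteq> u \<Longrightarrow> v \<bullet> w1 > 0"
  shows "{w. (\<forall>v\<in>V. v \<bullet> w \<ge> 0) \<and> u \<bullet> w = 0} facet_of {w. \<forall>v\<in>V. v \<bullet> w \<ge> 0}"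
    (is "?F facet_of ?S")
proof -
  have open_strict: "open {w. \<forall>v\<in>W. v \<bullet> w > 0}" if "W \<subseteq> V" for W
  proof -
    have "{w. \<forall>v\<in>W. v \<bullet> w > 0} = (\<Inter>v\<in>W. {w. v \<bullet> w > 0})"
      by auto
    then show ?thesis
      using that \<open>finite V\<close> by (auto intro!: open_INT open_halfspace_gt intro: finite_subset)
  qed
  have S_eq: "?S = (\<Inter>v\<in>V. {w. v \<bullet> w \<ge> 0})"
    by auto
  have "convex ?S"
    unfolding S_eq by (intro convex_INT convex_halfspace_ge)
  then have "(?S \<inter> {w. u \<bullet> w = 0}) face_of ?S"
    by (rule face_of_Int_supporting_hyperplane_ge) (use u in auto)
  moreover have F_eq: "?F = ?S \<inter> {w. u \<bullet> w = 0}"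
    by auto
  moreover have "w1 \<in> ?F"
    using w1 by (force intro: less_imp_le)
  moreover have "aff_dim ?S = int (DIM('e))"
  proof -
    have "aff_dim {w. \<forall>v\<in>V. v \<bullet> w > 0} = int (DIM('e))"
      using open_strict [of V] w0 by (intro aff_dim_open) auto
    moreover have "aff_dim {w. \<forall>v\<in>V. v \<bullet> w > 0} \<le> aff_dim ?S"
      by (intro aff_dim_subset) (auto intro: less_imp_le)
    ultimately show ?thesis
      using aff_dim_le_DIM [of ?S] by linarith
  qed
  moreover have "aff_dim ?F = int (DIM('e)) - 1"
  proof -
    let ?N = "{w. \<forall>v\<in>V - {u}. v \<bullet> w > 0}" and ?H = "{w. u \<bullet> w = 0}"
    have "aff_dim (?H \<inter> ?N) = aff_dim ?H"
      using open_strict [of "V - {u}"] w1 by (intro aff_dim_convex_Int_open convex_hyperplane) auto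
    moreover have "aff_dim (?H \<inter> ?N) \<le> aff_dim ?F"
      by (intro aff_dim_subset) (force intro: less_imp_le)
    moreover have "aff_dim ?F \<le> aff_dim ?H"
      by (intro aff_dim_subset) auto
    moreover have "aff_dim ?H = int (DIM('e)) - 1"
      using u(2) by simp
    ultimately show ?thesis
      by linarith
  qed
  ultimately show ?thesis
    unfolding facet_of_def by auto
qed

section \<open>Diamond inequalities as walls of the cone\<close>

context join_irreducible_partition
begin

definition defect_vector :: "'a \<Rightarrow> 'a \<Rightarrow> (real, 'a) vec" where
  "defect_vector a b = axis (sup a b) 1 + axis (dot a b) 1 - axis a 1 - axis b 1"

lemma inner_defect_vector: "defect_vector a b \<bullet> w = defect w a b"
  by (simp add: defect_vector_def defect_def inner_diff_left inner_add_left inner_axis' )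

lemma defect_vector_nonzero:
  assumes "diamond_pair a b"
  shows "defect_vector a b \<noteq> 0"
proof -
  have "dot a b \<le> b"
    using dot_le [of a b] by simp
  then have "dot a b \<noteq> a" "sup a b \<noteq> a" "a \<noteq> b"
    using diamond_pair_incomparable [OF assms] by (auto simp: sup.absorb_iff1)
  then have "defect_vector a b $ a = - 1"
    by (simp add: defect_vector_def axis_def)
  then show ?thesis
    by auto
qed

lemma card_iota_diamond:
  assumes "diamond_pair a b"
  shows "card (iota b) = card (iota a)" "card (iota (sup a b)) = Suc (card (iota a))"
    "card (iota (dot a b)) < card (iota a)"
proof -
  have covers: "covers (sup a b) a" "covers (sup a b) b" "covers a (inf a b)"
    using assms by (auto simp: diamond_pair_def)
  show "card (iota b) = card (iota a)" "card (iota (sup a b)) = Suc (card (iota a))"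
    using card_iota_covers [OF covers(1)] card_iota_covers [OF covers(2)] by simp_all
  have "iota (dot a b) \<subseteq> iota (inf a b)"
    unfolding iota_subset_iff by (rule dot_le)
  then have "card (iota (dot a b)) \<le> card (iota (inf a b))"
    by (intro card_mono) auto
  then show "card (iota (dot a b)) < card (iota a)"
    using card_iota_covers [OF covers(3)] by simp
qed

text \<open>With base \<open>3\<close> the join of a diamond pair outweighs its two members and
  leaves a surplus of \<open>3 ^ card (iota a)\<close>, which the construction of a point on a wall
  consumes.\<close>

definition rank_weight :: "(real, 'a) vec" where
  "rank_weight = (\<chi> x. 3 ^ card (iota x))"

lemma defect_rank_weight:
  assumes "diamond_pair a b"
  shows "defect rank_weight a b = 3 ^ card (iota a) + 3 ^ card (iota (dot a b))"
  using card_iota_diamond [OF assms] by (simp add: defect_def rank_weight_def)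

lemma defect_add: "defect (v + w) a b = defect v a b + defect w a b"
  by (simp add: defect_def)

lemma exists_weight_on_wall:
  assumes ab: "diamond_pair a b"
  obtains w where "defect w a b = 0"
    "\<And>c d. diamond_pair c d \<Longrightarrow> {c, d} \<noteq> {a, b} \<Longrightarrow> defect w c d > 0"
proof -
  \<comment> \<open>Raising the weight at \<open>a\<close> and \<open>b\<close> by \<open>s\<close> lowers the defect of \<open>a, b\<close> by \<open>2 * s\<close> but that of any
    other diamond pair by at most \<open>s\<close>, and \<open>rank_weight\<close> makes all defects at one rank comparable.\<close>
  define s where "s = defect rank_weight a b / 2"
  define e where "e = (\<chi> x. if x = a \<or> x = b then s else 0)"
  have not_sup: "sup c d \<noteq> c" "sup c d \<noteq> d" "dot c d \<noteq> c" "dot c d \<noteq> d" if "diamond_pair c d" for c d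
    using diamond_pair_incomparable [OF that] dot_le [of c d] by (metis le_inf_iff sup_ge1 sup_ge2)+
  have s_pos: "s > 0"
    unfolding s_def defect_rank_weight [OF ab] by (simp add: add_pos_pos)
  \<comment> \<open>Here \<open>s\<close> is the mean of \<open>3 ^ card (iota a)\<close> and the
    smaller power belonging to \<open>dot a b\<close>.\<close>
  have s_less: "s < 3 ^ card (iota a)"
  proof -
    have "(3::real) ^ card (iota (dot a b)) < 3 ^ card (iota a)"
      using card_iota_diamond(3) [OF ab] by (intro power_strict_increasing) auto
    then show ?thesis
      unfolding s_def defect_rank_weight [OF ab] by simp
  qed
  have "a \<noteq> b"
    using ab by (simp add: diamond_pair_def)
  \<comment> \<open>Neither \<open>sup a b\<close> nor \<open>dot a b\<close> is one of
    \<open>a, b\<close>, so only the two negative terms survive.\<close>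
  then have "defect e a b = - (2 * s)"
    using not_sup [OF ab] by (auto simp: defect_def e_def)
  then have "defect (rank_weight + e) a b = 0"
    by (simp add: defect_add s_def)
  moreover have "defect (rank_weight + e) c d > 0"
    if cd: "diamond_pair c d" and ne: "{c, d} \<noteq> {a, b}" for c d
  proof -
    have pos: "defect rank_weight c d > 3 ^ card (iota c)"
      using defect_rank_weight [OF cd] by simp
    have "c \<noteq> d"
      using cd by (simp add: diamond_pair_def)
    have e_nonneg: "e $ x \<ge> 0" for x
      using s_pos by (simp add: e_def)
    have lower: "defect e c d \<ge> - e $ c - e $ d"
      using e_nonneg [of "sup c d"] e_nonneg [of "dot c d"] by (simp add: defect_def)
    show ?thesis
    proof (cases "c \<in> {a, b} \<or> d \<in> {a, b}")
      case True
      then have "card (iota c) = card (iota a)"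
        using card_iota_diamond(1) [OF cd] card_iota_diamond(1) [OF ab] by auto
      \<comment> \<open>If both \<open>c\<close> and \<open>d\<close> were raised, being distinct
        they would form the excluded pair.\<close>
      moreover have "e $ c + e $ d \<le> s"
        using ne \<open>c \<noteq> d\<close> s_pos by (auto simp: e_def)
      ultimately show ?thesis
        using pos lower s_less unfolding defect_add by simp
    next
      case False
      then have "e $ c = 0" "e $ d = 0"
        by (auto simp: e_def)
      moreover have "(0::real) < 3 ^ card (iota c)"
        by simp
      ultimately show ?thesis
        using pos lower unfolding defect_add by linarith
    qed
  qed
  ultimately show thesis
    by (rule that)
qed

definition diamond_vectors :: "(real, 'a) vec set" where
  "diamond_vectors = {defect_vector a b | a b. diamond_pair a b}"

lemma rank_weight_pos: "v \<in> diamond_vectors \<Longrightarrow> v \<bullet> rank_weight > 0"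
  by (auto simp: diamond_vectors_def inner_defect_vector defect_rank_weight add_pos_pos)

lemma closure_groebner_cone:
  "closure (groebner_cone (hibi_ideal Uo Uc) monomial_ideal) = {w. \<forall>v\<in>diamond_vectors. v \<bullet> w \<ge> 0}"
proof -
  have "groebner_cone (hibi_ideal Uo Uc) monomial_ideal = {w. \<forall>v\<in>diamond_vectors. v \<bullet> w > 0}"
    unfolding groebner_cone_eq diamond_vectors_def by (auto simp flip: inner_defect_vector)
  then show ?thesis
    using closure_strict_halfspaces [of diamond_vectors rank_weight] rank_weight_pos by simp
qed

lemma diamond_facet:
  assumes ab: "diamond_pair a b"
  shows "{w \<in> closure (groebner_cone (hibi_ideal Uo Uc) monomial_ideal). defect w a b = 0}
    facet_of closure (groebner_cone (hibi_ideal Uo Uc) monomial_ideal)"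
proof -
  obtain w where w: "defect w a b = 0"
    "\<And>c d. diamond_pair c d \<Longrightarrow> {c, d} \<noteq> {a, b} \<Longrightarrow> defect w c d > 0"
    using exists_weight_on_wall [OF ab] by blast
  \<comment> \<open>The two orders of a pair give one vector, so any other vector comes from a
    different unordered pair and is strictly positive at \<open>w\<close>.\<close>
  have sym: "defect_vector c d = defect_vector a b" if "{c, d} = {a, b}" for c d
    using that by (auto simp: doubleton_eq_iff defect_vector_def dot_commute sup_commute)
  have "finite diamond_vectors"
  proof (rule finite_subset)
    show "diamond_vectors \<subseteq> (\<lambda>(a, b). defect_vector a b) ` UNIV"
      by (auto simp: diamond_vectors_def)
  qed simp
  then have "{w. (\<forall>v\<in>diamond_vectors. v \<bullet> w \<ge> 0) \<and> defect_vector a b \<bullet> w = 0}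
      facet_of {w. \<forall>v\<in>diamond_vectors. v \<bullet> w \<ge> 0}"
  proof (rule facet_of_halfspace_intersection [OF _ _ defect_vector_nonzero [OF ab] rank_weight_pos])
    show "defect_vector a b \<in> diamond_vectors"
      using ab by (auto simp: diamond_vectors_def)
    show "defect_vector a b \<bullet> w = 0"
      using w by (simp add: inner_defect_vector)
    show "v \<bullet> w > 0" if v: "v \<in> diamond_vectors" "v \<noteq> defect_vector a b" for v
    proof -
      obtain c d where cd: "diamond_pair c d" "v = defect_vector c d"
        using v(1) unfolding diamond_vectors_def by blast
      then have "{c, d} \<noteq> {a, b}"
        using v(2) sym by blast
      with cd show ?thesis
        using w(2) by (simp add: inner_defect_vector)
    qed
  qed
  then show ?thesis
    by (simp add: closure_groebner_cone inner_defect_vector)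
qed

end

theorem theorem5p7:
  fixes Uo Uc :: "'a::{finite,distrib_lattice} set"
  assumes "Uo \<union> Uc = join_irreducibles"
    and "Uo \<inter> Uc = {}"
  shows "groebner_cone (hibi_ideal Uo Uc) monomial_ideal =
      {w. \<forall>a b. diamond_pair a b \<longrightarrow>
         w $ a + w $ b < w $ sup a b + w $ odot Uo Uc a b} \<and>
    (\<forall>a b. diamond_pair a b \<longrightarrow>
      {w \<in> closure (groebner_cone (hibi_ideal Uo Uc) monomial_ideal).
         w $ a + w $ b = w $ sup a b + w $ odot Uo Uc a b}
      facet_of closure (groebner_cone (hibi_ideal Uo Uc) monomial_ideal))"
proof -
  interpret join_irreducible_partition Uo Uc
    using assms by unfold_locales
  have pos: "defect w a b > 0 \<longleftrightarrow> w $ a + w $ b < w $ sup a b + w $ odot Uo Uc a b"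
    and zero: "defect w a b = 0 \<longleftrightarrow> w $ a + w $ b = w $ sup a b + w $ odot Uo Uc a b" for w a b
    by (auto simp: defect_def)
  show ?thesis
    using groebner_cone_eq diamond_facet unfolding pos zero by blast
qed

end
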